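(* Let $0<q<1$, $w\ge1$, and for $i=1,\dots,w$ let $k_i,n_i\in\mathbb{N}_0$ and $x_i\in[0,1]$. Then \[ B_{k_1,\dots,k_w;n_1,\dots,n_w}(x_1,\dots,x_w;q)=\sum_{l_1=0}^{n_1}\cdots\sum_{l_w=0}^{n_w}\prod_{i=1}^{w}[x_i]_q^{k_i}\binom{n_i}{l_i}B_{l_i}^{(k_i)}\big([1-x_i]_q\big)S(n_i-l_i,k_i). \]
   Context: For $0<q<1$ and real $x$, $[x]_q=\frac{1-q^x}{1-q}$. For $k,n\in\mathbb{N}_0$ and $x\in[0,1]$, $B_{k;n}(x;q)=\binom{n}{k}[x]_q^{k}[1-x]_q^{n-k}$ if $k\le n$ and $0$ if $k>n$; and $B_{k_1,\dots,k_w;n_1,\dots,n_w}(x_1,\dots,x_w;q)=\prod_{i=1}^w B_{k_i;n_i}(x_i;q)$. The Bernoulli polynomials of order $k\in\mathbb{N}_0$ are defined by $\left(\frac{t}{e^t-1}\right)^k e^{xt}=\sum_{n\ge0}B_n^{(k)}(x)\frac{t^n}{n!}$, and the Stirling numbers of the second kind by $\frac{(e^t-1)^k}{k!}=\sum_{n\ge0}S(n,k)\frac{t^n}{n!}$. *)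

theory Defs
  imports
    Complex_Main
    "HOL-Library.FuncSet"
    "HOL-Computational_Algebra.Formal_Power_Series"
    "HOL-Combinatorics.Stirling"
begin

definition q_number :: "real \<Rightarrow> real \<Rightarrow> real" where
  "q_number q x = (1 - q powr x) / (1 - q)"

definition q_bernstein :: "real \<Rightarrow> nat \<Rightarrow> nat \<Rightarrow> real \<Rightarrow> real" where
  "q_bernstein q k n x =
     (if k \<le> n then real (n choose k) * q_number q x ^ k * q_number q (1 - x) ^ (n - k) else 0)"

definition q_bernstein_multi ::
  "real \<Rightarrow> nat \<Rightarrow> (nat \<Rightarrow> nat) \<Rightarrow> (nat \<Rightarrow> nat) \<Rightarrow> (nat \<Rightarrow> real) \<Rightarrow> real" where
  "q_bernstein_multi q w k n x = (\<Prod>i = 1..w. q_bernstein q (k i) (n i) (x i))"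

text \<open>
  The divisor \<open>fps_exp 1 - 1\<close> is not a unit (its constant coefficient is 0), but division of
  formal power series over a field cancels the common factor \<open>fps_X\<close>, so the quotient below
  is the power series of \<open>t / (e^t - 1)\<close>; see \<open>fps_X_over_exp_minus_1\<close>.
\<close>
definition bernoulli_order :: "nat \<Rightarrow> nat \<Rightarrow> real \<Rightarrow> real" where
  "bernoulli_order k n x =
     fact n * fps_nth ((fps_X / (fps_exp 1 - 1)) ^ k * fps_exp x) n"

lemma fps_X_over_exp_minus_1:
  "(fps_X / (fps_exp 1 - 1)) * (fps_exp 1 - 1 :: real fps) = fps_X"
proof -
  let ?F = "fps_exp 1 - 1 :: real fps"
  have s: "subdegree ?F = 1"
    by (rule subdegreeI) auto
  then have "?F dvd fps_X"
    by (subst fps_dvd_iff) auto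
  then show ?thesis
    by simp
qed

lemma bernoulli_order_egf:
  "(fps_X / (fps_exp 1 - 1)) ^ k * fps_exp x = Abs_fps (\<lambda>n. bernoulli_order k n x / fact n)"
  by (rule fps_ext) (simp add: bernoulli_order_def)

text \<open>
  The library defines \<open>Stirling\<close> by its recurrence; the next lemma is the defining
  generating function \<open>(e^t - 1)^k / k!\<close> of the Stirling numbers of the second kind.
\<close>
lemma Stirling_egf:
  "fps_const (1 / fact k) * (fps_exp 1 - 1 :: real fps) ^ k =
     Abs_fps (\<lambda>n. real (Stirling n k) / fact n)"
proof -
  let ?F = "fps_exp 1 - 1 :: real fps"
  define G where "G k = fps_const (1 / fact k) * ?F ^ k" for k
  have D: "fps_deriv (G (Suc k)) = of_nat (Suc k) * G (Suc k) + G k" for k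
  proof -
    have c: "fps_const (1 / fact (Suc k)) * of_nat (Suc k) = (fps_const (1 / fact k) :: real fps)"
      by (simp add: fps_of_nat [symmetric] field_simps del: of_nat_Suc)
    have "fps_deriv (G (Suc k)) = fps_const (1 / fact (Suc k)) * (of_nat (Suc k) * ?F ^ k * fps_exp 1)"
      unfolding G_def by (simp add: fps_deriv_power' del: power_Suc of_nat_Suc fact_Suc)
    also have "\<dots> = fps_const (1 / fact (Suc k)) * of_nat (Suc k) * (?F ^ Suc k + ?F ^ k)"
      by (simp add: algebra_simps)
    also have "\<dots> = of_nat (Suc k) * G (Suc k) + fps_const (1 / fact (Suc k)) * of_nat (Suc k) * ?F ^ k"
      unfolding G_def by (simp only: distrib_left mult_ac)
    also have "fps_const (1 / fact (Suc k)) * of_nat (Suc k) * ?F ^ k = G k"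
      unfolding c G_def ..
    finally show ?thesis .
  qed
  have "fps_nth (G k) n = real (Stirling n k) / fact n" for n
  proof (induction n k rule: Stirling.induct)
    case (4 n k)
    have "real (Suc n) * fps_nth (G (Suc k)) (Suc n) = fps_nth (fps_deriv (G (Suc k))) n"
      by simp
    also have "\<dots> = real (Suc k) * fps_nth (G (Suc k)) n + fps_nth (G k) n"
      unfolding D by (simp add: fps_of_nat [symmetric] del: of_nat_Suc)
    also have "\<dots> = real (Stirling (Suc n) (Suc k)) / fact n"
      using 4 by (simp add: field_simps)
    finally have "fps_nth (G (Suc k)) (Suc n) = real (Stirling (Suc n) (Suc k)) / fact n / real (Suc n)"
      by (metis nonzero_mult_div_cancel_left of_nat_neq_0)
    also have "\<dots> = real (Stirling (Suc n) (Suc k)) / fact (Suc n)"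
      by (simp only: fact_Suc of_nat_mult divide_divide_eq_left mult.commute)
    finally show ?case .
  qed (simp_all add: G_def fps_mult_nth)
  then show ?thesis
    unfolding G_def by (intro fps_ext) simp
qed

end

theory Submission
  imports Defs
begin

text \<open>
  The generating functions of \<open>bernoulli_order k\<close> and of \<open>Stirling\<close> multiply to
  \<open>t^k e^(yt) / k!\<close>, since the powers of \<open>e^t - 1\<close> cancel. Comparing coefficients gives the
  univariate identity, and the multivariate one is its product expanded by distributivity.
\<close>

lemma sum_bernoulli_order_Stirling:
  fixes y :: real
  shows "(\<Sum>l = 0..n. real (n choose l) * bernoulli_order k l y * real (Stirling (n - l) k)) =
    (if k \<le> n then real (n choose k) * y ^ (n - k) else 0)"
proof -
  let ?E = "fps_exp 1 - 1 :: real fps"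
  let ?B = "Abs_fps (\<lambda>n. bernoulli_order k n y / fact n)"
  let ?S = "Abs_fps (\<lambda>n. real (Stirling n k) / fact n)"
  have "?B * ?S = ((fps_X / ?E) ^ k * fps_exp y) * (fps_const (1 / fact k) * ?E ^ k)"
    by (simp only: bernoulli_order_egf Stirling_egf)
  \<comment> \<open>\<open>?E\<close> is not a unit, so the quotient is paired with
    \<open>?E\<close> under one \<open>k\<close>-th power, where the exact cancellation to
    \<open>fps_X\<close> applies.\<close>
  also have "\<dots> = fps_const (1 / fact k) * (((fps_X / ?E) * ?E) ^ k * fps_exp y)"
    by (simp only: power_mult_distrib mult_ac)
  also have "\<dots> = fps_const (1 / fact k) * (fps_X ^ k * fps_exp y)"
    by (simp only: fps_X_over_exp_minus_1)
  finally have egf: "?B * ?S = fps_const (1 / fact k) * (fps_X ^ k * fps_exp y)" .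
  have "(\<Sum>l = 0..n. real (n choose l) * bernoulli_order k l y * real (Stirling (n - l) k)) =
      fact n * fps_nth (?B * ?S) n"
    by (auto simp: fps_mult_nth sum_distrib_left binomial_fact intro!: sum.cong)
  \<comment> \<open>The factor \<open>fps_X ^ k\<close> shifts the exponential series by
    \<open>k\<close>: the coefficient is 0 for n < k, and otherwise
    \<open>fact n / (fact k * fact (n - k))\<close> is the binomial.\<close>
  also have "\<dots> = (if k \<le> n then real (n choose k) * y ^ (n - k) else 0)"
    unfolding egf by (simp add: fps_X_power_mult_nth binomial_fact)
  finally show ?thesis .
qed

text \<open>Take \<open>y = q_number q (1 - x)\<close> in the previous identity; the power of
  \<open>q_number q x\<close> is constant in \<open>l\<close>.\<close>

lemma q_bernstein_eq_sum_bernoulli_order_Stirling: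
  "q_bernstein q k n x =
    (\<Sum>l = 0..n. q_number q x ^ k * real (n choose l) *
      bernoulli_order k l (q_number q (1 - x)) * real (Stirling (n - l) k))"
proof -
  have "(\<Sum>l = 0..n. q_number q x ^ k * real (n choose l) *
      bernoulli_order k l (q_number q (1 - x)) * real (Stirling (n - l) k)) =
    q_number q x ^ k * (\<Sum>l = 0..n. real (n choose l) *
      bernoulli_order k l (q_number q (1 - x)) * real (Stirling (n - l) k))"
    by (simp only: sum_distrib_left mult.assoc)
  then show ?thesis
    by (simp add: sum_bernoulli_order_Stirling q_bernstein_def)
qed

theorem theorem2p13:
  fixes q :: real and w :: nat and k n :: "nat \<Rightarrow> nat" and x :: "nat \<Rightarrow> real"
  assumes "0 < q" and "q < 1"
    and "w \<ge> 1"
    and "\<And>i. i \<in> {1..w} \<Longrightarrow> 0 \<le> x i \<and> x i \<le> 1"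
  shows "q_bernstein_multi q w k n x =
    (\<Sum>l \<in> (\<Pi>\<^sub>E i\<in>{1..w}. {0..n i}).
      \<Prod>i = 1..w. q_number q (x i) ^ k i * real (n i choose l i) *
        bernoulli_order (k i) (l i) (q_number q (1 - x i)) * real (Stirling (n i - l i) (k i)))"
  unfolding q_bernstein_multi_def q_bernstein_eq_sum_bernoulli_order_Stirling
  \<comment> \<open>Choosing one index per factor amounts to choosing \<open>l\<close> in the
    \<open>PiE\<close> set, which encodes the \<open>w\<close> nested sums.\<close>
  by (rule prod_sum_PiE) simp_all

end
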